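(* Consider the SDDBM forward dynamics $$\mathrm{d}\mathbf{x}_t=\left(f_t\mathbf{x}_t+m_t\mathbf{x}^{\star}+h_t\boldsymbol{\mu}\right)\mathrm{d}t+\eta_t\,\mathrm{d}\mathbf{w}_t,\qquad 0\le t<T,$$ whose coefficients $f_t,m_t,h_t,\eta_t$ are the functions (given in the context) of the hyperparameters $(\theta_t,\boldsymbol{\mu},\alpha,\beta,\gamma,\hat{\sigma}^2)$. This framework recovers the diffusion bridge models DDBM-VP, DDBM-VE, GOUB and UniDB as special cases. Namely, with $\alpha=0$, $\beta=1$, $\gamma=0$ in all cases, the dynamics become: (1) DDBM-VP, for $\theta_t=\frac12 g_t^2$, $\boldsymbol{\mu}=\mathbf{0}$, $\hat{\sigma}^2=0$: $$\mathrm{d}\mathbf{x}_t=\left[-\left(\tfrac12 g_t^2+g_t^2\frac{e^{-2\bar{\theta}_{t:T}}}{\bar{\sigma}_{t:T}^2}\right)\mathbf{x}_t+g_t^2\frac{e^{-\bar{\theta}_{t:T}}}{\bar{\sigma}_{t:T}^2}\mathbf{x}^{\star}\right]\mathrm{d}t+g_t\,\mathrm{d}\mathbf{w}_t ;$$ (2) DDBM-VE, for $\theta_t=0$, $\boldsymbol{\mu}=\mathbf{0}$, $\hat{\sigma}^2=0$: $$\mathrm{d}\mathbf{x}_t=g_t^2\frac{\mathbf{x}^{\star}-\mathbf{x}_t}{\bar{\sigma}_{t:T}^2}\,\mathrm{d}t+g_t\,\mathrm{d}\mathbf{w}_t ;$$ (3) GOUB, for $\theta_t=\frac{1}{2\lambda^2}g_t^2$,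 $\boldsymbol{\mu}=\mathbf{x}^{\star}$, $\hat{\sigma}^2=0$: $$\mathrm{d}\mathbf{x}_t=\left(\theta_t+g_t^2\frac{e^{-2\bar{\theta}_{t:T}}}{\bar{\sigma}_{t:T}^2}\right)(\mathbf{x}^{\star}-\mathbf{x}_t)\,\mathrm{d}t+g_t\,\mathrm{d}\mathbf{w}_t ;$$ (4) UniDB, for $\theta_t=\frac{1}{2\lambda^2}g_t^2$, $\boldsymbol{\mu}=\mathbf{x}^{\star}$, $\hat{\sigma}^2=\kappa^{-1}$: $$\mathrm{d}\mathbf{x}_t=\left(\theta_t+g_t^2\frac{e^{-2\bar{\theta}_{t:T}}}{\kappa^{-1}+\bar{\sigma}_{t:T}^2}\right)(\mathbf{x}^{\star}-\mathbf{x}_t)\,\mathrm{d}t+g_t\,\mathrm{d}\mathbf{w}_t .$$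
   Context: Here $\mathbf{x}^{\star}\in\mathbb{R}^d$ is the target endpoint, $g_t>0$ is a deterministic diffusion coefficient, $\lambda>0$ and $\kappa>0$ are constants, $\mathbf{w}$ is a standard $d$-dimensional Wiener process, and $$\bar{\theta}_{s:t}=\int_s^t\theta_u\,\mathrm{d}u,\qquad \bar{\sigma}_{s:t}^2=\int_s^t e^{-2\bar{\theta}_{u:t}}g_u^2\,\mathrm{d}u .$$ The parameter $\sigma^2\in[0,\bar{\sigma}_{0:T}^2)$ is tied to $\hat{\sigma}^2\ge0$ by $\hat{\sigma}^2=\dfrac{\sigma^2\bar{\sigma}_{0:T}^2}{\bar{\sigma}_{0:T}^2-\sigma^2}$. The SDDBM coefficients are $$\phi_t=e^{-\bar{\theta}_{0:t}}(\hat{\sigma}^2+\bar{\sigma}_{t:T}^2)+\alpha e^{\bar{\theta}_{t:T}}(\bar{\sigma}_{0:T}^2-\bar{\sigma}_{t:T}^2),\qquad \varphi_t=\sigma^2(\bar{\sigma}_{0:T}^2-\bar{\sigma}_{t:T}^2)+\bar{\sigma}_{t:T}^2\bar{\sigma}_{0:T}^2,$$ $$f_t=\frac{g_t^2e^{-\bar{\theta}_{t:T}}(\alpha-e^{-\bar{\theta}_{0:T}})}{\phi_t}-\theta_t,\qquad m_t=\frac{g_t^2\beta e^{-\bar{\theta}_{0:T}}}{\phi_t},$$ $$h_t=\theta_t+\frac{g_t^2e^{-\bar{\theta}_{t:T}}\left[e^{-\bar{\theta}_{0:T}}+(\gamma-1)e^{-\bar{\theta}_{0:t}}+\alpha(e^{-\bar{\theta}_{0:t}}-1)\right]}{\phi_t},$$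 $$\eta_t=\frac{g_t}{\bar{\sigma}_{0:T}^2}\left\{\varphi_t\left[1-\frac{2e^{-\bar{\theta}_{t:T}}\bar{\sigma}_{0:t}^2(\alpha-e^{-\bar{\theta}_{0:T}})}{\phi_t}\right]+\bar{\sigma}_{0:t}^2e^{-2\bar{\theta}_{t:T}}(\sigma^2-\bar{\sigma}_{0:T}^2)\right\}^{1/2}.$$ DDBM-VP and DDBM-VE (denoising diffusion bridge models with variance-preserving / variance-exploding reference process), GOUB (generalized Ornstein–Uhlenbeck bridge) and UniDB (finite terminal penalty $\kappa$) are by definition the bridge models with the forward SDEs displayed in (1)–(4). "Recovers" means that the drift and diffusion coefficients of the SDDBM dynamics coincide with those displayed. *)

theory Defs
  imports "HOL-Analysis.Analysis"
begin

text \<open>An SDE \<open>dx\<^sub>t = b(t, x\<^sub>t) dt + s(t) dw\<^sub>t\<close> in \<open>\<real>\<^sup>d\<close>, driven by a standard \<open>d\<close>-dimensional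
  Wiener process, is represented by its coefficients; all SDEs here have a scalar, state-independent
  diffusion coefficient, acting as \<open>s(t)\<close> times the identity.\<close>

record ('d::finite) sde =
  drift :: "real \<Rightarrow> real ^ 'd \<Rightarrow> real ^ 'd"
  diffusion :: "real \<Rightarrow> real"

definition same_dynamics :: "real \<Rightarrow> ('d::finite) sde \<Rightarrow> 'd sde \<Rightarrow> bool" where
  "same_dynamics T A B \<longleftrightarrow>
     (\<forall>t\<in>{0..<T}. (\<forall>x. drift A t x = drift B t x) \<and> diffusion A t = diffusion B t)"

definition theta_bar :: "(real \<Rightarrow> real) \<Rightarrow> real \<Rightarrow> real \<Rightarrow> real" where
  "theta_bar \<theta> s t = integral {s..t} \<theta>"

text \<open>The quantity \<open>\<sigma>\<^sup>2\<close> with a bar; names ending in \<open>2\<close> denote squared quantities throughout.\<close>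

definition sigma_bar2 :: "(real \<Rightarrow> real) \<Rightarrow> (real \<Rightarrow> real) \<Rightarrow> real \<Rightarrow> real \<Rightarrow> real" where
  "sigma_bar2 \<theta> g s t = integral {s..t} (\<lambda>u. exp (- 2 * theta_bar \<theta> u t) * (g u)^2)"

text \<open>The hyperparameter is \<open>\<sigma>hat2\<close>; \<open>\<sigma>\<^sup>2\<close> is the parameter tied to it. With
  \<open>S = sigma_bar2 \<theta> g 0 T\<close>, the description is meaningful whenever \<open>S > 0\<close> and
  \<open>\<sigma>hat2 \<ge> 0\<close>, see \<open>ex1_tied_sigma2\<close>.\<close>

definition tied_sigma2 :: "real \<Rightarrow> real \<Rightarrow> real" where
  "tied_sigma2 S \<sigma>hat2 = (THE \<sigma>2. 0 \<le> \<sigma>2 \<and> \<sigma>2 < S \<and> \<sigma>hat2 = \<sigma>2 * S / (S - \<sigma>2))"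

lemma ex1_tied_sigma2:
  assumes "S > 0" "\<sigma>hat2 \<ge> 0"
  shows "\<exists>!\<sigma>2::real. 0 \<le> \<sigma>2 \<and> \<sigma>2 < S \<and> \<sigma>hat2 = \<sigma>2 * S / (S - \<sigma>2)"
proof (rule ex1I[where a = "\<sigma>hat2 * S / (S + \<sigma>hat2)"])
  have p: "S + \<sigma>hat2 > 0" using assms by simp
  have d: "S - \<sigma>hat2 * S / (S + \<sigma>hat2) = S * S / (S + \<sigma>hat2)"
    using p by (simp add: field_simps)
  have pos: "S * S / (S + \<sigma>hat2) > 0" using assms p by simp
  have "\<sigma>hat2 * S / (S + \<sigma>hat2) < S" using d pos by linarith
  moreover have "\<sigma>hat2 = \<sigma>hat2 * S / (S + \<sigma>hat2) * S / (S - \<sigma>hat2 * S / (S + \<sigma>hat2))"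
    unfolding d using assms p by simp
  ultimately show "0 \<le> \<sigma>hat2 * S / (S + \<sigma>hat2) \<and> \<sigma>hat2 * S / (S + \<sigma>hat2) < S \<and>
      \<sigma>hat2 = \<sigma>hat2 * S / (S + \<sigma>hat2) * S / (S - \<sigma>hat2 * S / (S + \<sigma>hat2))"
    using assms p by simp
next
  fix \<sigma>2 assume a: "0 \<le> \<sigma>2 \<and> \<sigma>2 < S \<and> \<sigma>hat2 = \<sigma>2 * S / (S - \<sigma>2)"
  then have "\<sigma>hat2 * (S - \<sigma>2) = \<sigma>2 * S" by simp
  then have "\<sigma>2 * (S + \<sigma>hat2) = \<sigma>hat2 * S" by (simp add: algebra_simps)
  then show "\<sigma>2 = \<sigma>hat2 * S / (S + \<sigma>hat2)"
    using assms by (simp add: eq_divide_eq)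
qed

definition phi_coef ::
    "real \<Rightarrow> (real \<Rightarrow> real) \<Rightarrow> (real \<Rightarrow> real) \<Rightarrow> real \<Rightarrow> real \<Rightarrow> real \<Rightarrow> real" where
  "phi_coef T g \<theta> \<alpha> \<sigma>hat2 t =
     exp (- theta_bar \<theta> 0 t) * (\<sigma>hat2 + sigma_bar2 \<theta> g t T)
     + \<alpha> * exp (theta_bar \<theta> t T) * (sigma_bar2 \<theta> g 0 T - sigma_bar2 \<theta> g t T)"

definition varphi_coef ::
    "real \<Rightarrow> (real \<Rightarrow> real) \<Rightarrow> (real \<Rightarrow> real) \<Rightarrow> real \<Rightarrow> real \<Rightarrow> real" where
  "varphi_coef T g \<theta> \<sigma>hat2 t =
     tied_sigma2 (sigma_bar2 \<theta> g 0 T) \<sigma>hat2 * (sigma_bar2 \<theta> g 0 T - sigma_bar2 \<theta> g t T)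
     + sigma_bar2 \<theta> g t T * sigma_bar2 \<theta> g 0 T"

definition f_coef ::
    "real \<Rightarrow> (real \<Rightarrow> real) \<Rightarrow> (real \<Rightarrow> real) \<Rightarrow> real \<Rightarrow> real \<Rightarrow> real \<Rightarrow> real" where
  "f_coef T g \<theta> \<alpha> \<sigma>hat2 t =
     (g t)^2 * exp (- theta_bar \<theta> t T) * (\<alpha> - exp (- theta_bar \<theta> 0 T))
       / phi_coef T g \<theta> \<alpha> \<sigma>hat2 t
     - \<theta> t"

definition m_coef ::
    "real \<Rightarrow> (real \<Rightarrow> real) \<Rightarrow> (real \<Rightarrow> real) \<Rightarrow> real \<Rightarrow> real \<Rightarrow> real \<Rightarrow> real \<Rightarrow> real" where
  "m_coef T g \<theta> \<alpha> \<beta> \<sigma>hat2 t =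
     (g t)^2 * \<beta> * exp (- theta_bar \<theta> 0 T) / phi_coef T g \<theta> \<alpha> \<sigma>hat2 t"

definition h_coef ::
    "real \<Rightarrow> (real \<Rightarrow> real) \<Rightarrow> (real \<Rightarrow> real) \<Rightarrow> real \<Rightarrow> real \<Rightarrow> real \<Rightarrow> real \<Rightarrow> real" where
  "h_coef T g \<theta> \<alpha> \<gamma> \<sigma>hat2 t =
     \<theta> t
     + (g t)^2 * exp (- theta_bar \<theta> t T) *
         (exp (- theta_bar \<theta> 0 T) + (\<gamma> - 1) * exp (- theta_bar \<theta> 0 t)
          + \<alpha> * (exp (- theta_bar \<theta> 0 t) - 1))
       / phi_coef T g \<theta> \<alpha> \<sigma>hat2 t"

definition eta_coef ::
    "real \<Rightarrow> (real \<Rightarrow> real) \<Rightarrow> (real \<Rightarrow> real) \<Rightarrow> real \<Rightarrow> real \<Rightarrow> real \<Rightarrow> real" where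
  "eta_coef T g \<theta> \<alpha> \<sigma>hat2 t =
     g t / sigma_bar2 \<theta> g 0 T *
     sqrt (varphi_coef T g \<theta> \<sigma>hat2 t *
             (1 - 2 * exp (- theta_bar \<theta> t T) * sigma_bar2 \<theta> g 0 t
                    * (\<alpha> - exp (- theta_bar \<theta> 0 T))
                  / phi_coef T g \<theta> \<alpha> \<sigma>hat2 t)
           + sigma_bar2 \<theta> g 0 t * exp (- 2 * theta_bar \<theta> t T)
             * (tied_sigma2 (sigma_bar2 \<theta> g 0 T) \<sigma>hat2 - sigma_bar2 \<theta> g 0 T))"

definition sddbm ::
    "real \<Rightarrow> (real \<Rightarrow> real) \<Rightarrow> real ^ 'd \<Rightarrow>
     (real \<Rightarrow> real) \<Rightarrow> real ^ 'd \<Rightarrow> real \<Rightarrow> real \<Rightarrow> real \<Rightarrow> real \<Rightarrow> ('d::finite) sde" where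
  "sddbm T g xstar \<theta> \<mu> \<alpha> \<beta> \<gamma> \<sigma>hat2 =
     \<lparr> drift = (\<lambda>t x. f_coef T g \<theta> \<alpha> \<sigma>hat2 t *\<^sub>R x + m_coef T g \<theta> \<alpha> \<beta> \<sigma>hat2 t *\<^sub>R xstar
                       + h_coef T g \<theta> \<alpha> \<gamma> \<sigma>hat2 t *\<^sub>R \<mu>),
       diffusion = eta_coef T g \<theta> \<alpha> \<sigma>hat2 \<rparr>"

definition theta_vp :: "(real \<Rightarrow> real) \<Rightarrow> real \<Rightarrow> real" where
  "theta_vp g t = 1 / 2 * (g t)^2"

definition theta_gou :: "real \<Rightarrow> (real \<Rightarrow> real) \<Rightarrow> real \<Rightarrow> real" where
  "theta_gou lam g t = 1 / (2 * lam^2) * (g t)^2"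

definition ddbm_vp :: "real \<Rightarrow> (real \<Rightarrow> real) \<Rightarrow> real ^ 'd \<Rightarrow> ('d::finite) sde" where
  "ddbm_vp T g xstar =
     \<lparr> drift = (\<lambda>t x.
         - (1 / 2 * (g t)^2
            + (g t)^2 * (exp (- 2 * theta_bar (theta_vp g) t T) / sigma_bar2 (theta_vp g) g t T)) *\<^sub>R x
         + ((g t)^2 * (exp (- theta_bar (theta_vp g) t T) / sigma_bar2 (theta_vp g) g t T)) *\<^sub>R xstar),
       diffusion = g \<rparr>"

definition ddbm_ve :: "real \<Rightarrow> (real \<Rightarrow> real) \<Rightarrow> real ^ 'd \<Rightarrow> ('d::finite) sde" where
  "ddbm_ve T g xstar =
     \<lparr> drift = (\<lambda>t x. (g t)^2 *\<^sub>R ((xstar - x) /\<^sub>R sigma_bar2 (\<lambda>_. 0) g t T)),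
       diffusion = g \<rparr>"

definition goub :: "real \<Rightarrow> real \<Rightarrow> (real \<Rightarrow> real) \<Rightarrow> real ^ 'd \<Rightarrow> ('d::finite) sde" where
  "goub lam T g xstar =
     \<lparr> drift = (\<lambda>t x.
         (theta_gou lam g t
          + (g t)^2 * (exp (- 2 * theta_bar (theta_gou lam g) t T)
                       / sigma_bar2 (theta_gou lam g) g t T)) *\<^sub>R (xstar - x)),
       diffusion = g \<rparr>"

definition unidb :: "real \<Rightarrow> real \<Rightarrow> real \<Rightarrow> (real \<Rightarrow> real) \<Rightarrow> real ^ 'd \<Rightarrow> ('d::finite) sde" where
  "unidb lam kappa T g xstar =
     \<lparr> drift = (\<lambda>t x.
         (theta_gou lam g t
          + (g t)^2 * (exp (- 2 * theta_bar (theta_gou lam g) t T)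
                       / (inverse kappa + sigma_bar2 (theta_gou lam g) g t T))) *\<^sub>R (xstar - x)),
       diffusion = g \<rparr>"

end

theory Submission
  imports Defs
begin

text \<open>For \<open>\<alpha> = \<gamma> = 0\<close>, \<open>\<beta> = 1\<close> the factor \<open>exp (- theta_bar \<theta> 0 t)\<close> of \<open>phi_coef\<close> cancels against the
  numerators. With \<open>A = sigma_bar2 \<theta> g t T\<close>, \<open>S = sigma_bar2 \<theta> g 0 T\<close> and the splitting
  \<open>S = exp (- 2 * theta_bar \<theta> t T) * sigma_bar2 \<theta> g 0 t + A\<close>, the radicand of \<open>eta_coef\<close> becomes
  \<open>S\<^sup>2 * ((\<sigma>hat2 + A + 2 * (S - A)) - (S - A)) / (S + \<sigma>hat2) = S\<^sup>2\<close>. Division by \<open>\<sigma>hat2 + A\<close> is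
  legitimate because \<open>g > 0\<close> forces \<open>A > 0\<close> for \<open>t < T\<close>.\<close>

text \<open>\<open>f\<close> need not be continuous, so no pointwise lower bound is at hand.
  Nonnegativity turns gauge integrability into Lebesgue integrability, where a strict inequality of
  integrands on a set of nonzero measure passes to the integrals.\<close>

lemma integral_pos_if_pos:
  fixes f :: "real \<Rightarrow> real"
  assumes f: "f integrable_on {a..b}" and "a < b" and pos: "\<And>x. x \<in> {a..b} \<Longrightarrow> f x > 0"
  shows "integral {a..b} f > 0"
proof -
  have "set_integrable lebesgue {a..b} f"
    using f pos by (intro nonnegative_absolutely_integrable_1) (auto intro: less_imp_le)
  then have "integrable (lebesgue_on {a..b}) f"
    by (simp add: integrable_restrict_space set_integrable_def)
  moreover have "emeasure (lebesgue_on {a..b}) (space (lebesgue_on {a..b})) \<noteq> 0"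
    using \<open>a < b\<close> by (simp add: emeasure_restrict_space)
  ultimately have "integral\<^sup>L (lebesgue_on {a..b}) (\<lambda>_. 0) < integral\<^sup>L (lebesgue_on {a..b}) f"
    using pos by (intro finite_measure.integral_less_AE_space finite_measure_lebesgue_on) auto
  then show ?thesis
    using \<open>integrable (lebesgue_on {a..b}) f\<close> by (simp add: lebesgue_integral_eq_integral)
qed

text \<open>Nonnegativity makes \<open>h\<close> absolutely integrable. That property survives a
  bounded measurable factor, and a continuous function on a compact interval is one.\<close>

lemma integrable_continuous_mult_nonneg:
  fixes f h :: "real \<Rightarrow> real"
  assumes "continuous_on {a..b} f" and "h integrable_on {a..b}"
    and "\<And>x. x \<in> {a..b} \<Longrightarrow> h x \<ge> 0"
  shows "(\<lambda>x. f x * h x) integrable_on {a..b}"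
proof -
  have "h absolutely_integrable_on {a..b}"
    using assms by (intro nonnegative_absolutely_integrable_1)
  moreover have "f \<in> borel_measurable (lebesgue_on {a..b})"
    using assms by (intro continuous_imp_measurable_on_sets_lebesgue) auto
  moreover have "bounded (f ` {a..b})"
    using assms by (intro compact_imp_bounded compact_continuous_image) auto
  ultimately have "(\<lambda>x. f x * h x) absolutely_integrable_on {a..b}"
    by (intro absolutely_integrable_bounded_measurable_product_real) auto
  then show ?thesis
    by (rule absolutely_integrable_on_def[THEN iffD1, THEN conjunct1])
qed

lemma theta_bar_combine:
  assumes "\<theta> integrable_on {0..T}" "0 \<le> r" "r \<le> s" "s \<le> t" "t \<le> T"
  shows "theta_bar \<theta> r t = theta_bar \<theta> r s + theta_bar \<theta> s t"
  unfolding theta_bar_def using assms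
  by (intro Henstock_Kurzweil_Integration.integral_combine[symmetric]
        integrable_subinterval_real[OF assms(1)]) auto

lemma sigma_bar2_integrable:
  assumes \<theta>: "\<theta> integrable_on {0..T}" and g: "(\<lambda>t. (g t)^2) integrable_on {0..T}"
    and "0 \<le> s" "t \<le> T"
  shows "(\<lambda>u. exp (- 2 * theta_bar \<theta> u t) * (g u)^2) integrable_on {s..t}"
proof (rule integrable_continuous_mult_nonneg)
  have "\<theta> integrable_on {s..t}" "(\<lambda>t. (g t)^2) integrable_on {s..t}"
    using assms by (auto intro: integrable_subinterval_real)
  \<comment> \<open>An indefinite integral is continuous in its lower limit.\<close>
  then show "continuous_on {s..t} (\<lambda>u. exp (- 2 * theta_bar \<theta> u t))"
    and "(\<lambda>t. (g t)^2) integrable_on {s..t}"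
    unfolding theta_bar_def by (auto intro!: continuous_intros indefinite_integral_continuous_1')
qed auto

lemma sigma_bar2_pos:
  assumes "\<theta> integrable_on {0..T}" "(\<lambda>t. (g t)^2) integrable_on {0..T}"
    and "\<And>t. t \<in> {0..T} \<Longrightarrow> g t > 0" and "0 \<le> s" "s < t" "t \<le> T"
  shows "sigma_bar2 \<theta> g s t > 0"
  unfolding sigma_bar2_def
proof (rule integral_pos_if_pos[OF sigma_bar2_integrable])
  show "exp (- 2 * theta_bar \<theta> u t) * (g u)^2 > 0" if "u \<in> {s..t}" for u
    using assms(3)[of u] assms(4-6) that by simp
qed (use assms in auto)

text \<open>Variance accumulated up to \<open>t\<close> is damped over the remaining time: on
  \<open>{0..t}\<close> the exponent splits at \<open>t\<close>, and the part from \<open>t\<close>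
  to \<open>T\<close> is constant in \<open>u\<close>.\<close>

lemma sigma_bar2_combine:
  assumes \<theta>: "\<theta> integrable_on {0..T}" and g: "(\<lambda>t. (g t)^2) integrable_on {0..T}"
    and "0 \<le> t" "t \<le> T"
  shows "sigma_bar2 \<theta> g 0 T
    = exp (- 2 * theta_bar \<theta> t T) * sigma_bar2 \<theta> g 0 t + sigma_bar2 \<theta> g t T"
proof -
  have "integral {0..t} (\<lambda>u. exp (- 2 * theta_bar \<theta> u T) * (g u)^2)
      = integral {0..t} (\<lambda>u. exp (- 2 * theta_bar \<theta> t T) * (exp (- 2 * theta_bar \<theta> u t) * (g u)^2))"
  proof (rule Henstock_Kurzweil_Integration.integral_cong)
    fix u assume "u \<in> {0..t}"
    then have "theta_bar \<theta> u T = theta_bar \<theta> u t + theta_bar \<theta> t T"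
      using assms by (intro theta_bar_combine[OF \<theta>]) auto
    then show "exp (- 2 * theta_bar \<theta> u T) * (g u)^2
      = exp (- 2 * theta_bar \<theta> t T) * (exp (- 2 * theta_bar \<theta> u t) * (g u)^2)"
      by (simp add: algebra_simps flip: exp_add)
  qed
  then have "integral {0..t} (\<lambda>u. exp (- 2 * theta_bar \<theta> u T) * (g u)^2)
      = exp (- 2 * theta_bar \<theta> t T) * sigma_bar2 \<theta> g 0 t"
    by (simp add: sigma_bar2_def)
  then show ?thesis
    unfolding sigma_bar2_def
    using Henstock_Kurzweil_Integration.integral_combine[OF \<open>0 \<le> t\<close> \<open>t \<le> T\<close>
        sigma_bar2_integrable[OF \<theta> g order.refl order.refl]]
    by simp
qed

lemma tied_sigma2_eq:
  assumes "S > 0" "\<sigma>hat2 \<ge> 0"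
  shows "tied_sigma2 S \<sigma>hat2 = \<sigma>hat2 * S / (S + \<sigma>hat2)"
proof -
  have "0 \<le> tied_sigma2 S \<sigma>hat2 \<and> tied_sigma2 S \<sigma>hat2 < S
      \<and> \<sigma>hat2 = tied_sigma2 S \<sigma>hat2 * S / (S - tied_sigma2 S \<sigma>hat2)"
    unfolding tied_sigma2_def by (rule theI'[OF ex1_tied_sigma2[OF assms]])
  \<comment> \<open>The strict bound by \<open>S\<close> keeps the denominator nonzero; once
    cleared, the relation is linear in the tied parameter.\<close>
  then have "\<sigma>hat2 * (S - tied_sigma2 S \<sigma>hat2) = tied_sigma2 S \<sigma>hat2 * S"
    by (metis diff_gt_0_iff_gt nonzero_eq_divide_eq less_irrefl)
  then show ?thesis
    using assms by (simp add: eq_divide_eq algebra_simps)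
qed

text \<open>Keeps \<open>\<theta>\<close> abstract, so that the coefficients are computed once for
  all models.\<close>

locale bridge_schedule =
  fixes T :: real and g \<theta> :: "real \<Rightarrow> real"
  assumes g_pos: "\<And>t. t \<in> {0..T} \<Longrightarrow> g t > 0"
    and g_integrable: "(\<lambda>t. (g t)^2) integrable_on {0..T}"
    and theta_integrable: "\<theta> integrable_on {0..T}"
begin

lemma eta_coef_eq:
  assumes t: "0 \<le> t" "t < T" and "\<sigma>hat2 \<ge> 0"
  shows "eta_coef T g \<theta> 0 \<sigma>hat2 t = g t"
proof -
  define e A B S where defs: "e = exp (- theta_bar \<theta> t T)" "A = sigma_bar2 \<theta> g t T"
    "B = sigma_bar2 \<theta> g 0 t" "S = sigma_bar2 \<theta> g 0 T"
  have pos: "A > 0" "S > 0"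
    unfolding defs using t
    by (auto intro!: sigma_bar2_pos[OF theta_integrable g_integrable g_pos])
  have e2: "exp (- 2 * theta_bar \<theta> t T) = e^2"
    by (simp add: defs flip: exp_double)
  have S: "S = e^2 * B + A"
    unfolding defs e2[unfolded defs, symmetric]
    using sigma_bar2_combine[OF theta_integrable g_integrable] t by simp
  have E: "exp (- theta_bar \<theta> 0 T) = exp (- theta_bar \<theta> 0 t) * e"
    using theta_bar_combine[OF theta_integrable, of 0 t T] t by (simp add: defs flip: exp_add)
  \<comment> \<open>Over the common denominator the terms in \<open>\<sigma>hat2 * S * A\<close>
    cancel, leaving the factor \<open>S^2\<close>.\<close>
  have varphi: "varphi_coef T g \<theta> \<sigma>hat2 t = S^2 * (\<sigma>hat2 + A) / (S + \<sigma>hat2)"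
    using pos \<open>\<sigma>hat2 \<ge> 0\<close> unfolding varphi_coef_def defs(2,4)[symmetric]
    by (simp add: tied_sigma2_eq field_simps power2_eq_square)
  \<comment> \<open>\<open>E\<close> supplies a second factor \<open>e\<close>, and
    \<open>e^2 * B = S - A\<close> by the splitting.\<close>
  have phi: "2 * e * B * (0 - exp (- theta_bar \<theta> 0 T)) / phi_coef T g \<theta> 0 \<sigma>hat2 t
      = - 2 * (S - A) / (\<sigma>hat2 + A)"
    unfolding phi_coef_def defs(2)[symmetric] E S
    by (simp add: power2_eq_square)
  have tied: "tied_sigma2 S \<sigma>hat2 - S = - (S^2) / (S + \<sigma>hat2)"
    using pos \<open>\<sigma>hat2 \<ge> 0\<close> by (simp add: tied_sigma2_eq field_simps power2_eq_square)
  have "eta_coef T g \<theta> 0 \<sigma>hat2 t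
      = g t / S * sqrt (S^2 * (\<sigma>hat2 + A) / (S + \<sigma>hat2) * (1 - (- 2 * (S - A) / (\<sigma>hat2 + A)))
          + (S - A) * (- (S^2) / (S + \<sigma>hat2)))"
    unfolding eta_coef_def varphi e2 defs(1,3,4)[symmetric] phi tied
    by (simp add: S mult.commute)
  also have "1 - (- 2 * (S - A) / (\<sigma>hat2 + A)) = (\<sigma>hat2 + A + 2 * (S - A)) / (\<sigma>hat2 + A)"
    using pos \<open>\<sigma>hat2 \<ge> 0\<close> by (simp add: field_simps)
  also have "S^2 * (\<sigma>hat2 + A) / (S + \<sigma>hat2) * ((\<sigma>hat2 + A + 2 * (S - A)) / (\<sigma>hat2 + A))
      = S^2 * (\<sigma>hat2 + A + 2 * (S - A)) / (S + \<sigma>hat2)"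
    using pos \<open>\<sigma>hat2 \<ge> 0\<close> by simp
  also have "\<dots> + (S - A) * (- (S^2) / (S + \<sigma>hat2))
      = S^2 * (\<sigma>hat2 + A + 2 * (S - A) - (S - A)) / (S + \<sigma>hat2)"
    by (simp add: algebra_simps diff_divide_distrib add_divide_distrib)
  also have "\<dots> = S^2"
    using pos \<open>\<sigma>hat2 \<ge> 0\<close> by simp
  finally show ?thesis
    using pos by simp
qed

text \<open>Only the nonzero factor \<open>exp (- theta_bar \<theta> 0 t)\<close> is cancelled and
  \<open>D\<close> stays a denominator, so the identities hold even for
  \<open>D = 0\<close>.\<close>

lemma sddbm_drift_coefs:
  fixes \<sigma>hat2 :: real
  assumes t: "0 \<le> t" "t < T"
  defines "e \<equiv> exp (- theta_bar \<theta> t T)" and "D \<equiv> \<sigma>hat2 + sigma_bar2 \<theta> g t T"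
  shows "f_coef T g \<theta> 0 \<sigma>hat2 t = - (\<theta> t + (g t)^2 * (e^2 / D))"
    and "m_coef T g \<theta> 0 1 \<sigma>hat2 t = (g t)^2 * (e / D)"
    and "h_coef T g \<theta> 0 0 \<sigma>hat2 t = \<theta> t + (g t)^2 * (e^2 / D) - (g t)^2 * (e / D)"
proof -
  have E: "exp (- theta_bar \<theta> 0 T) = exp (- theta_bar \<theta> 0 t) * e"
    using theta_bar_combine[OF theta_integrable, of 0 t T] t by (simp add: e_def flip: exp_add)
  have phi: "phi_coef T g \<theta> 0 \<sigma>hat2 t = exp (- theta_bar \<theta> 0 t) * D"
    by (simp add: phi_coef_def D_def)
  show "f_coef T g \<theta> 0 \<sigma>hat2 t = - (\<theta> t + (g t)^2 * (e^2 / D))"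
    unfolding f_coef_def phi E e_def[symmetric] by (simp add: power2_eq_square)
  show "m_coef T g \<theta> 0 1 \<sigma>hat2 t = (g t)^2 * (e / D)"
    unfolding m_coef_def phi E by simp
  have "exp (- theta_bar \<theta> 0 t) * e + (0 - 1) * exp (- theta_bar \<theta> 0 t)
      + 0 * (exp (- theta_bar \<theta> 0 t) - 1) = exp (- theta_bar \<theta> 0 t) * (e - 1)"
    by (simp add: algebra_simps)
  then show "h_coef T g \<theta> 0 0 \<sigma>hat2 t = \<theta> t + (g t)^2 * (e^2 / D) - (g t)^2 * (e / D)"
    unfolding h_coef_def phi E e_def[symmetric]
    by (simp add: power2_eq_square right_diff_distrib diff_divide_distrib)
qed

text \<open>A normal form of the drift that leaves only vector algebra for each model: the last
  summand vanishes for \<open>\<mu> = 0\<close>, and for \<open>\<mu> = xstar\<close> the terms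
  linear in \<open>exp (- theta_bar \<theta> t T)\<close> cancel.\<close>

lemma same_dynamics_sddbmI:
  assumes "\<sigma>hat2 \<ge> 0" and "diffusion B = g"
    and "\<And>t x. 0 \<le> t \<Longrightarrow> t < T \<Longrightarrow> drift B t x =
      - (\<theta> t + (g t)^2 * (exp (- 2 * theta_bar \<theta> t T) / (\<sigma>hat2 + sigma_bar2 \<theta> g t T))) *\<^sub>R x
      + ((g t)^2 * (exp (- theta_bar \<theta> t T) / (\<sigma>hat2 + sigma_bar2 \<theta> g t T))) *\<^sub>R xstar
      + (\<theta> t + (g t)^2 * (exp (- 2 * theta_bar \<theta> t T) / (\<sigma>hat2 + sigma_bar2 \<theta> g t T))
         - (g t)^2 * (exp (- theta_bar \<theta> t T) / (\<sigma>hat2 + sigma_bar2 \<theta> g t T))) *\<^sub>R \<mu>"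
  shows "same_dynamics T (sddbm T g xstar \<theta> \<mu> 0 1 0 \<sigma>hat2) B"
proof -
  have "(exp (- theta_bar \<theta> t T))^2 = exp (- 2 * theta_bar \<theta> t T)" for t
    by (simp flip: exp_double)
  then show ?thesis
    using assms by (auto simp: same_dynamics_def sddbm_def sddbm_drift_coefs eta_coef_eq)
qed

end

theorem proposition4p1:
  fixes T lam kappa :: real and g :: "real \<Rightarrow> real" and xstar :: "real ^ 'd::finite"
  assumes "T > 0" and "lam > 0" and "kappa > 0"
    and "\<And>t. t \<in> {0..T} \<Longrightarrow> g t > 0"
    and "(\<lambda>t. (g t)^2) integrable_on {0..T}"
  shows "same_dynamics T
           (sddbm T g xstar (\<lambda>t. 1 / 2 * (g t)^2) 0 0 1 0 0)
           (ddbm_vp T g xstar) \<and>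
         same_dynamics T
           (sddbm T g xstar (\<lambda>t. 0) 0 0 1 0 0)
           (ddbm_ve T g xstar) \<and>
         same_dynamics T
           (sddbm T g xstar (\<lambda>t. 1 / (2 * lam^2) * (g t)^2) xstar 0 1 0 0)
           (goub lam T g xstar) \<and>
         same_dynamics T
           (sddbm T g xstar (\<lambda>t. 1 / (2 * lam^2) * (g t)^2) xstar 0 1 0 (inverse kappa))
           (unidb lam kappa T g xstar)"
proof -
  have vp: "(\<lambda>t. 1 / 2 * (g t)^2) = theta_vp g"
    and gou: "(\<lambda>t. 1 / (2 * lam^2) * (g t)^2) = theta_gou lam g"
    by (auto simp: theta_vp_def theta_gou_def)
  \<comment> \<open>Each schedule is a constant multiple of \<open>(g t)^2\<close>, the zero
    schedule included.\<close>
  have "bridge_schedule T g (\<lambda>t. c * (g t)^2)" for c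
    using assms by unfold_locales (auto intro: integrable_on_mult_right)
  from this[of "1 / 2"] this[of 0] this[of "1 / (2 * lam^2)"]
  interpret VP: bridge_schedule T g "theta_vp g"
    + VE: bridge_schedule T g "\<lambda>_. 0"
    + GOU: bridge_schedule T g "theta_gou lam g"
    unfolding vp gou by simp_all
  show ?thesis
    unfolding vp gou
  proof (intro conjI)
    show "same_dynamics T (sddbm T g xstar (theta_vp g) 0 0 1 0 0) (ddbm_vp T g xstar)"
      by (rule VP.same_dynamics_sddbmI) (simp_all add: ddbm_vp_def theta_vp_def[of g])
    \<comment> \<open>All exponentials become 1, so the coefficients of \<open>x\<close> and
      \<open>xstar\<close> are opposite.\<close>
    have "theta_bar (\<lambda>_. 0) t T = 0" for t
      by (simp add: theta_bar_def)
    then show "same_dynamics T (sddbm T g xstar (\<lambda>t. 0) 0 0 1 0 0) (ddbm_ve T g xstar)"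
      by (intro VE.same_dynamics_sddbmI)
        (simp_all add: ddbm_ve_def divide_inverse scaleR_right_diff_distrib)
    show "same_dynamics T (sddbm T g xstar (theta_gou lam g) xstar 0 1 0 0) (goub lam T g xstar)"
      by (rule GOU.same_dynamics_sddbmI) (simp_all add: goub_def algebra_simps)
    show "same_dynamics T (sddbm T g xstar (theta_gou lam g) xstar 0 1 0 (inverse kappa))
        (unidb lam kappa T g xstar)"
      using \<open>kappa > 0\<close>
      by (intro GOU.same_dynamics_sddbmI) (simp_all add: unidb_def algebra_simps)
  qed
qed

end
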